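(* Let $m\ge 1$ be an integer, let $n=2m$, and let $a,b\in\mathbb{C}$ be arbitrary. Let $H_n(a,b)$ be the $(n+1)\times(n+1)$ tridiagonal matrix with zero diagonal whose only possibly non-zero entries are, for $k\in\{1,\dots,n\}$, $$h_{k,k+1}=\begin{cases} k & \text{if } k \text{ is even}\\ k+a & \text{if } k \text{ is odd}\end{cases}\qquad\text{and}\qquad h_{n+2-k,\,n+1-k}=\begin{cases} k & \text{if } k \text{ is even}\\ k+b & \text{if } k \text{ is odd,}\end{cases}$$ that is, $$H_n(a,b)=\begin{pmatrix} 0 & 1+a & & & & & \\ n & 0 & 2 & & & & \\ & n-1+b & 0 & 3+a & & & \\ & & \ddots & \ddots & \ddots & & \\ & & & 3+b & 0 & n-1+a & \\ & & & & 2 & 0 & n\\ & & & & & 1+b & 0 \end{pmatrix}.$$ Then the $2m+1$ eigenvalues of $H_n(a,b)$ (counted with algebraic multiplicity) are $$0,\qquad \pm\sqrt{(2k)(2k+a+b)}\quad\text{for } k\in\{1,\dots,m\}.$$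
   Context: Rows and columns of matrices are indexed from $1$ to $n+1$. The symbol $\pm\sqrt{z}$ for a complex number $z$ denotes the two complex square roots of $z$ (both equal to $0$ if $z=0$), so each $k$ contributes two eigenvalues, counted with multiplicity. *)

theory Defs
  imports "Jordan_Normal_Form.Char_Poly" Complex_Main
begin

definition off_diag_weight :: "complex \<Rightarrow> nat \<Rightarrow> complex" where
  "off_diag_weight c k = (if even k then of_nat k else of_nat k + c)"

text \<open>
  Entries in the 1-based indexing \<open>i, j \<in> {1..n+1}\<close>.
  The subdiagonal entry at \<open>(n + 2 - k, n + 1 - k)\<close> carries weight \<open>k\<close>; in terms of the
  column \<open>j = n + 1 - k\<close> this is \<open>k = n + 1 - j\<close>, where \<open>j \<le> n\<close>, so that the subtraction
  on \<^typ>\<open>nat\<close> is not truncated.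
\<close>

definition H_entry :: "nat \<Rightarrow> complex \<Rightarrow> complex \<Rightarrow> nat \<Rightarrow> nat \<Rightarrow> complex" where
  "H_entry n a b i j =
     (if j = i + 1 then off_diag_weight a i
      else if i = j + 1 then off_diag_weight b (n + 1 - j)
      else 0)"

text \<open>Matrices of type \<^typ>\<open>complex mat\<close> are indexed from 0, hence the shift by 1.\<close>

definition H_mat :: "nat \<Rightarrow> complex \<Rightarrow> complex \<Rightarrow> complex mat" where
  "H_mat n a b = mat (n + 1) (n + 1) (\<lambda>(i, j). H_entry n a b (i + 1) (j + 1))"

text \<open>
  The multiset of roots of the characteristic polynomial: over the complex numbers these are
  the eigenvalues, each occurring with its algebraic multiplicity.
\<close>

definition eigenvalue_mset :: "complex mat \<Rightarrow> complex multiset" where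
  "eigenvalue_mset A = proots (char_poly A)"

text \<open>The two square roots of \<open>z\<close>; for \<open>z = 0\<close> this is \<open>{#0, 0#}\<close>.\<close>

definition sqrt_pair :: "complex \<Rightarrow> complex multiset" where
  "sqrt_pair z = {# csqrt z, - csqrt z #}"

end

theory Submission
  imports Defs
begin

text \<open>
  On homogeneous polynomials of degree \<open>n = 2 m\<close> in \<open>x, y\<close>, with basis \<open>x\<^sup>i y\<^sup>n\<^sup>-\<^sup>i\<close>, the matrix
  represents \<open>y D\<^sub>x + x D\<^sub>y\<close>, where \<open>D\<^sub>x\<close> and \<open>D\<^sub>y\<close> are the Dunkl operators sending \<open>x\<^sup>k\<close> to
  \<open>k x\<^sup>k\<^sup>-\<^sup>1\<close> for even \<open>k\<close> and to \<open>(k + a) x\<^sup>k\<^sup>-\<^sup>1\<close> (for \<open>y\<close>: \<open>(k + b) y\<^sup>k\<^sup>-\<^sup>1\<close>) for odd \<open>k\<close>.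
  In the basis
  \<open>E\<^sub>j = (y\<^sup>2 - x\<^sup>2)\<^sup>m\<^sup>-\<^sup>j x\<^sup>2\<^sup>j\<close> and \<open>O\<^sub>j = x y (y\<^sup>2 - x\<^sup>2)\<^sup>m\<^sup>-\<^sup>1\<^sup>-\<^sup>j x\<^sup>2\<^sup>j\<close> it acts by
  \<open>E\<^sub>j \<mapsto> 2 j O\<^sub>j\<^sub>-\<^sub>1\<close> and \<open>O\<^sub>j \<mapsto> (2 j + 1 + a) E\<^sub>j + (2 j + 2 + a + b) E\<^sub>j\<^sub>+\<^sub>1\<close>. Ordered as
  \<open>E\<^sub>0, O\<^sub>0, E\<^sub>1, O\<^sub>1, \<dots>, E\<^sub>m\<close>, this is block upper triangular with diagonal blocks \<open>0\<close> on \<open>E\<^sub>0\<close>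
  and, on \<open>O\<^sub>k\<^sub>-\<^sub>1, E\<^sub>k\<close>, a block of characteristic polynomial \<open>X\<^sup>2 - 2 k (2 k + a + b)\<close>.
\<close>

section \<open>Binomial coefficient identities for the two basis families\<close>

text \<open>The coefficient of \<open>u\<^sup>r v\<^sup>N\<^sup>-\<^sup>r\<close> in \<open>(v - u)\<^sup>N\<^sup>-\<^sup>j u\<^sup>j\<close>, for \<open>j \<le> N\<close>.\<close>

definition alt_binom :: "nat \<Rightarrow> nat \<Rightarrow> nat \<Rightarrow> complex" where
  "alt_binom N r j = (if j \<le> r then (- 1) ^ (r - j) * of_nat ((N - j) choose (r - j)) else 0)"

lemma binomial_Suc_mult: "Suc t * (N choose Suc t) = (N - t) * (N choose t)"
  by (simp only: binomial_absorption binomial_absorb_comp)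

text \<open>With \<open>u = x^2\<close> and \<open>v = y^2\<close>, the operator acts on
  \<open>E_j\<close> as \<open>2 x y (d/du + d/dv)\<close>, a derivation that kills
  \<open>v - u\<close>. After division by \<open>2 x y\<close> this compares coefficients of
  \<open>u^r v^(m-1-r)\<close>.\<close>

lemma alt_binom_absorb:
  assumes "r < m" "j \<le> m"
  shows "of_nat (Suc r) * alt_binom m (Suc r) j + of_nat (m - r) * alt_binom m r j
       = of_nat j * alt_binom (m - 1) r (j - 1)"
proof (cases "j \<le> r")
  case True
  then obtain t where t: "r = j + t" by (auto simp: le_iff_add)
  obtain N where N: "m = j + N" using assms by (auto simp: le_iff_add)
  have eq: "of_nat (Suc t) * of_nat (N choose Suc t)
      = of_nat (N - t) * (of_nat (N choose t) :: complex)"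
    by (metis of_nat_mult binomial_Suc_mult)
  \<comment> \<open>For \<open>j = 0\<close> the truncated index \<open>j - 1\<close> is harmless,
    since the factor \<open>j\<close> is zero.\<close>
  have below: "of_nat j * alt_binom (m - 1) r (j - 1)
      = of_nat j * ((- 1) ^ Suc t * of_nat (N choose Suc t))"
    using t N by (cases j) (simp_all add: alt_binom_def Suc_diff_le)
  have above: "alt_binom m (Suc r) j = (- 1) ^ Suc t * of_nat (N choose Suc t)"
    "alt_binom m r j = (- 1) ^ t * of_nat (N choose t)"
    using t N by (simp_all add: alt_binom_def Suc_diff_le)
  have idx: "m - r = N - t" "of_nat (Suc r) = of_nat j + (of_nat (Suc t) :: complex)"
    using t N by simp_all
  define x y u v where "x = (of_nat (N choose Suc t) :: complex)"
    and "y = (of_nat (N choose t) :: complex)" and "u = (of_nat (Suc t) :: complex)"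
    and "v = (of_nat (N - t) :: complex)"
  have "u * x = v * y" using eq by (simp add: x_def y_def u_def v_def)
  then have "(- 1) ^ t * ((of_nat j + u) * (- x) + v * y) = (- 1) ^ t * (of_nat j * (- x))"
    by (simp add: algebra_simps)
  then show ?thesis
    unfolding below above idx x_def[symmetric] y_def[symmetric] u_def[symmetric] v_def[symmetric]
    by (simp add: algebra_simps)
next
  case False
  then show ?thesis
    by (cases "j = Suc r") (auto simp: alt_binom_def)
qed

text \<open>Both sides are the coefficient of \<open>u^r v^(m-r)\<close> in the image of
  \<open>O_j\<close>. For \<open>j < r\<close>, Pascal's rule splits \<open>alt_binom m r j\<close>
  and binomial absorption cancels the rest; for \<open>j > r\<close> every term vanishes.\<close>

lemma alt_binom_recurrence:
  assumes "r \<le> m" "j < m"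
  shows "(of_nat (2 * r + 1) + a) * alt_binom (m - 1) r j
       + (if 0 < r then (of_nat (2 * (m - r) + 1) + b) * alt_binom (m - 1) (r - 1) j else 0)
       = (of_nat (2 * j + 1) + a) * alt_binom m r j
       + (of_nat (2 * j + 2) + a + b) * alt_binom m r (Suc j)"
proof (cases "j < r")
  case True
  then obtain t where t: "r = j + Suc t" using less_imp_Suc_add by fastforce
  obtain N where N: "m = j + Suc N" using assms less_imp_Suc_add by fastforce
  have eq: "of_nat (Suc t) * of_nat (N choose Suc t)
      = of_nat (N - t) * (of_nat (N choose t) :: complex)"
    by (metis of_nat_mult binomial_Suc_mult)
  have 1: "alt_binom (m - 1) r j = (- 1) ^ Suc t * of_nat (N choose Suc t)"
     "alt_binom (m - 1) (r - 1) j = (- 1) ^ t * of_nat (N choose t)"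
     "alt_binom m r j = (- 1) ^ Suc t * (of_nat (N choose Suc t) + of_nat (N choose t))"
     "alt_binom m r (Suc j) = (- 1) ^ t * of_nat (N choose t)"
     "m - r = N - t"
    using t N by (simp_all add: alt_binom_def Suc_diff_le add.commute)
  have 2: "of_nat (2 * r + 1) = of_nat (2 * j + 1) + 2 * (of_nat (Suc t) :: complex)"
    "of_nat (2 * (N - t) + 1) = 2 * (of_nat (N - t) :: complex) + 1" using t by simp_all
  have 3: "0 < r" using t by simp
  define x y u v where "x = (of_nat (N choose Suc t) :: complex)" and
    "y = (of_nat (N choose t) :: complex)" and "u = (of_nat (Suc t) :: complex)"
    and "v = (of_nat (N - t) :: complex)"
  have e: "u * x = v * y" using eq by (simp add: x_def y_def u_def v_def)
  have "(of_nat (2 * j + 1) + 2 * u + a) * (- x) + (2 * v + 1 + b) * y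
     = (of_nat (2 * j + 1) + a) * (- (x + y)) + (of_nat (2 * j + 2) + a + b) * y"
    using e by (simp add: algebra_simps)
  then have "(-1)^t * ((of_nat (2 * j + 1) + 2 * u + a) * (- x) + (2 * v + 1 + b) * y)
     = (-1)^t * ((of_nat (2 * j + 1) + a) * (- (x + y)) + (of_nat (2 * j + 2) + a + b) * y)"
    by simp
  then show ?thesis unfolding 1 2 if_P[OF 3] x_def[symmetric] y_def[symmetric]
     u_def[symmetric] v_def[symmetric] by (simp add: algebra_simps)
next
  case False
  then show ?thesis by (auto simp: alt_binom_def)
qed

section \<open>The change of basis\<close>

text \<open>Column \<open>k\<close> lists the monomial coefficients of \<open>E\<^sub>j\<close> if \<open>k = 2 j\<close> and of \<open>O\<^sub>j\<close> if \<open>k = 2 j + 1\<close>.\<close>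

definition dunkl_basis :: "nat \<Rightarrow> nat \<Rightarrow> nat \<Rightarrow> complex" where
  "dunkl_basis m i k =
     (if even i \<noteq> even k then 0
      else alt_binom (if even k then m else m - 1) (i div 2) (k div 2))"

definition block_entry :: "complex \<Rightarrow> complex \<Rightarrow> nat \<Rightarrow> nat \<Rightarrow> complex" where
  "block_entry a b i k =
     (if k = i + 1 then off_diag_weight a k
      else if i = k + 1 then (if odd k then of_nat i + a + b else 0)
      else 0)"

text \<open>The operator swaps the \<open>E\<close> and \<open>O\<close> families, so equal parities
  give \<open>0 = 0\<close>. Even \<open>k\<close> is twice \<open>alt_binom_absorb\<close>, odd
  \<open>k\<close> is \<open>alt_binom_recurrence\<close>; the guards cut off neighbours outside the
  matrix.\<close>

lemma dunkl_basis_intertwines: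
  assumes "i \<le> 2 * m" "k \<le> 2 * m"
  shows "(if i < 2 * m then off_diag_weight a (i + 1) * dunkl_basis m (i + 1) k else 0)
       + (if 0 < i then off_diag_weight b (2 * m - (i - 1)) * dunkl_basis m (i - 1) k else 0)
       = (if 0 < k then dunkl_basis m i (k - 1) * off_diag_weight a k else 0)
       + (if k < 2 * m then dunkl_basis m i (k + 1) *
            (if odd k then of_nat (k + 1) + a + b else 0) else 0)"
proof (cases "even i = even k")
  case True
  then show ?thesis by (auto simp: dunkl_basis_def)
next
  case neq: False
  show ?thesis
  proof (cases "even k")
    case True
    then obtain j where k: "k = 2 * j" by blast
    obtain r where i: "i = 2 * r + 1" using neq True by (meson oddE)
    have r: "r < m" "j \<le> m" using assms i k by auto
    have "complex_of_nat (m * 2 - r * 2) = of_nat (2 * (m - r))"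
      by (rule arg_cong[where f = of_nat]) simp
    then have d: "complex_of_nat (m * 2 - r * 2) = 2 * of_nat (m - r)" by simp
    have "2 * of_nat (Suc r) * alt_binom m (Suc r) j + 2 * of_nat (m - r) * alt_binom m r j
       = 2 * of_nat j * alt_binom (m - 1) r (j - 1)"
      using arg_cong[OF alt_binom_absorb[OF r], of "\<lambda>x. 2 * x"]
      by (simp add: algebra_simps)
    then show ?thesis using r i k d
      by (cases j) (simp_all add: dunkl_basis_def off_diag_weight_def algebra_simps flip: of_nat_diff)
  next
    case False
    then obtain j where k: "k = 2 * j + 1" using oddE by blast
    obtain r where i: "i = 2 * r" using neq False by blast
    have r: "r \<le> m" "j < m" using assms i k by auto
    \<comment> \<open>At \<open>r = m\<close> the guard \<open>i < 2 * m\<close> removes the first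
      term; the recurrence has no such guard, but its coefficient vanishes there.\<close>
    have z: "alt_binom (m - Suc 0) m j = 0" using r by (simp add: alt_binom_def)
    show ?thesis
    proof (cases r)
      case 0
      then show ?thesis using alt_binom_recurrence[OF r, of a b] r i k
        by (simp add: dunkl_basis_def off_diag_weight_def algebra_simps)
    next
      case (Suc s)
      have "2 * m - (2 * r - Suc 0) = 2 * (m - r) + 1" using Suc r by simp
      then show ?thesis using alt_binom_recurrence[OF r, of a b] r i k z Suc
        by (cases "r = m") (simp_all add: dunkl_basis_def off_diag_weight_def algebra_simps flip: of_nat_diff)
    qed
  qed
qed

lemma sum_tridiagonal:
  fixes f g :: "nat \<Rightarrow> 'a :: comm_monoid_add"
  shows "(\<Sum>l\<in>{0..<N}. if l = i + 1 then f l else if i = l + 1 then g l else 0)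
       = (if i + 1 < N then f (i + 1) else 0) + (if 0 < i \<and> i \<le> N then g (i - 1) else 0)"
proof -
  have "(\<Sum>l\<in>{0..<N}. if l = i + 1 then f l else if i = l + 1 then g l else 0)
     = (\<Sum>l\<in>{0..<N}. (if l = i + 1 then f l else 0) + (if 0 < i \<and> l = i - 1 then g l else 0))"
    by (intro sum.cong) auto
  also have "\<dots> = (\<Sum>l\<in>{0..<N}. if l = i + 1 then f l else 0)
     + (if 0 < i then (\<Sum>l\<in>{0..<N}. if l = i - 1 then g l else 0) else 0)"
    by (simp add: sum.distrib)
  also have "\<dots> = (if i + 1 < N then f (i + 1) else 0) + (if 0 < i \<and> i \<le> N then g (i - 1) else 0)"
    by (cases i) auto
  finally show ?thesis .
qed

definition block_mat :: "nat \<Rightarrow> complex \<Rightarrow> complex \<Rightarrow> complex mat" where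
  "block_mat m a b = mat (2 * m + 1) (2 * m + 1) (\<lambda>(i, k). block_entry a b i k)"

definition dunkl_mat :: "nat \<Rightarrow> complex mat" where
  "dunkl_mat m = mat (2 * m + 1) (2 * m + 1) (\<lambda>(i, k). dunkl_basis m i k)"

lemma H_mat_mult_dunkl_mat: "H_mat (2 * m) a b * dunkl_mat m = dunkl_mat m * block_mat m a b"
proof (rule eq_matI)
  fix i k assume "i < dim_row (dunkl_mat m * block_mat m a b)" "k < dim_col (dunkl_mat m * block_mat m a b)"
  then have ik: "i \<le> 2 * m" "k \<le> 2 * m" by (simp_all add: dunkl_mat_def block_mat_def)
  have "(H_mat (2 * m) a b * dunkl_mat m) $$ (i, k)
     = (\<Sum>l\<in>{0..<2 * m + 1}. H_entry (2 * m) a b (i + 1) (l + 1) * dunkl_basis m l k)"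
    using ik by (simp add: H_mat_def dunkl_mat_def scalar_prod_def)
  also have "\<dots> = (\<Sum>l\<in>{0..<2 * m + 1}. if l = i + 1 then off_diag_weight a (i + 1) * dunkl_basis m l k
      else if i = l + 1 then off_diag_weight b (2 * m - l) * dunkl_basis m l k else 0)"
    by (intro sum.cong) (auto simp: H_entry_def)
  \<comment> \<open>\<open>sum_tridiagonal\<close> collapses both sums, around row \<open>i\<close>
    on the left and around column \<open>k\<close> on the right.\<close>
  also have "\<dots> = (\<Sum>l\<in>{0..<2 * m + 1}. if l = k + 1 then dunkl_basis m i l *
            (if odd k then of_nat (k + 1) + a + b else 0)
      else if k = l + 1 then dunkl_basis m i l * off_diag_weight a k else 0)"
    unfolding sum_tridiagonal using dunkl_basis_intertwines[OF ik, of a b] ik by (simp add: add.commute)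
  also have "\<dots> = (\<Sum>l\<in>{0..<2 * m + 1}. dunkl_basis m i l * block_entry a b l k)"
    by (intro sum.cong) (auto simp: block_entry_def)
  also have "\<dots> = (dunkl_mat m * block_mat m a b) $$ (i, k)"
    using ik by (simp add: block_mat_def dunkl_mat_def scalar_prod_def)
  finally show "(H_mat (2 * m) a b * dunkl_mat m) $$ (i, k) = (dunkl_mat m * block_mat m a b) $$ (i, k)" .
qed (simp_all add: H_mat_def dunkl_mat_def block_mat_def)

text \<open>The lowest power of \<open>x\<close> in column \<open>k\<close> is \<open>x^k\<close>,
  with coefficient 1, so the matrix is lower unitriangular.\<close>

lemma det_dunkl_mat_nonzero: "det (dunkl_mat m) \<noteq> 0"
proof -
  have "det (dunkl_mat m) = prod_list (diag_mat (dunkl_mat m))"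
  proof (rule det_lower_triangular[of "2 * m + 1"])
    fix i k assume ik: "i < k" "k < 2 * m + 1"
    have "i div 2 < k div 2" if "even i = even k"
      using that ik(1) by presburger
    then show "dunkl_mat m $$ (i, k) = 0"
      using ik by (cases "even i = even k") (auto simp: dunkl_mat_def dunkl_basis_def alt_binom_def)
  qed (simp add: dunkl_mat_def)
  also have "\<dots> \<noteq> 0"
    by (auto simp: prod_list_zero_iff diag_mat_def dunkl_mat_def dunkl_basis_def alt_binom_def)
  finally show ?thesis .
qed

section \<open>Similarity and the characteristic polynomial of the block triangular matrix\<close>

lemma similar_mat_if_intertwined:
  fixes A B P :: "'a :: field mat"
  assumes A: "A \<in> carrier_mat n n" and B: "B \<in> carrier_mat n n" and P: "P \<in> carrier_mat n n"
    and "det P \<noteq> 0" and AP: "A * P = P * B"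
  shows "similar_mat A B"
proof -
  from det_non_zero_imp_unit[OF P \<open>det P \<noteq> 0\<close>, where b = "()"]
  obtain Q where Q: "Q \<in> carrier_mat n n" "P * Q = 1\<^sub>m n" "Q * P = 1\<^sub>m n"
    by (auto simp: Units_def ring_mat_def)
  have "A = A * (P * Q)" using A Q by simp
  also have "\<dots> = P * B * Q" using AP assoc_mult_mat[OF A P Q(1)] by simp
  finally show ?thesis using A B P Q by (intro similar_matI[of _ _ P Q n]) auto
qed

lemma det_2_by_2:
  fixes A :: "'a :: comm_ring_1 mat"
  assumes "A \<in> carrier_mat 2 2"
  shows "det A = A $$ (0, 0) * A $$ (1, 1) - A $$ (0, 1) * A $$ (1, 0)"
  by (subst laplace_expansion_row[OF assms, of 0])
    (use assms in \<open>auto simp: cofactor_def mat_delete_def det_single numeral_2_eq_2\<close>)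

lemma char_poly_four_block_lower_left_zero:
  fixes A D :: "'a :: idom mat"
  assumes "A \<in> carrier_mat n n" "B \<in> carrier_mat n k" "D \<in> carrier_mat k k"
  shows "char_poly (four_block_mat A B (0\<^sub>m k n) D) = char_poly A * char_poly D"
proof -
  let ?cm = "\<lambda>A. [:0, 1:] \<cdot>\<^sub>m 1\<^sub>m (dim_row A) + map_mat (\<lambda>a. [:- a:]) A"
  have "?cm (four_block_mat A B (0\<^sub>m k n) D)
      = four_block_mat (?cm A) (map_mat (\<lambda>a. [:- a:]) B) (0\<^sub>m k n) (?cm D)"
    by (rule eq_matI) (use assms in \<open>auto simp: one_poly_def\<close>)
  also have "det \<dots> = det (?cm A) * det (?cm D)"
    by (rule det_four_block_mat_lower_left_zero[OF _ _ refl]) (use assms in auto)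
  finally show ?thesis by (simp add: char_poly_defs)
qed

text \<open>Induction on \<open>m\<close>: \<open>block_entry\<close> does not depend on
  \<open>m\<close>, so each step keeps the old matrix as upper left block and appends the diagonal
  block of \<open>O_m, E_(m+1)\<close>.\<close>

lemma char_poly_block_mat:
  "char_poly (block_mat m a b) =
     [:0, 1:] * (\<Prod>k\<in>{1..m}. [:- ((2 * of_nat k) * (2 * of_nat k + a + b)), 0, 1:])"
proof (induction m)
  case 0
  show ?case
    by (simp add: char_poly_defs block_mat_def block_entry_def det_single)
next
  case (Suc m)
  let ?n = "2 * m + 1"
  let ?B = "mat ?n 2 (\<lambda>(i, k). block_entry a b i (k + ?n))"
  let ?D = "mat 2 2 (\<lambda>(i, k). block_entry a b (i + ?n) (k + ?n))"
  have "block_mat (Suc m) a b = four_block_mat (block_mat m a b) ?B (0\<^sub>m 2 ?n) ?D"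
    (is "_ = ?F")
  proof (rule eq_matI)
    fix i k assume "i < dim_row ?F" "k < dim_col ?F"
    then have ik: "i < ?n + 2" "k < ?n + 2" by (simp_all add: block_mat_def)
    \<comment> \<open>The only tridiagonal position in the lower left block lies in column
      \<open>2 * m\<close>, which is even, so its subdiagonal entry is zero.\<close>
    have "block_entry a b i k = 0" if "k < ?n" "\<not> i < ?n"
    proof -
      have "even k" if "i = k + 1" using that \<open>k < ?n\<close> \<open>\<not> i < ?n\<close> by presburger
      then show ?thesis using that by (auto simp: block_entry_def)
    qed
    then show "block_mat (Suc m) a b $$ (i, k) = ?F $$ (i, k)"
      using ik by (cases "i < ?n"; cases "k < ?n") (simp_all add: block_mat_def)
  qed (simp_all add: block_mat_def)
  then have "char_poly (block_mat (Suc m) a b) = char_poly (block_mat m a b) * char_poly ?D"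
    by (simp only: char_poly_four_block_lower_left_zero[of _ ?n _ 2] block_mat_def mat_carrier)
  also have "char_poly ?D =
      [:- ((2 * of_nat (Suc m)) * (2 * of_nat (Suc m) + a + b)), 0, 1:]"
    unfolding char_poly_defs
    by (subst det_2_by_2) (auto simp: block_entry_def off_diag_weight_def algebra_simps)
  finally show ?case unfolding Suc.IH
    by (simp only: prod.nat_ivl_Suc'[OF le_add1[of 1 m, unfolded plus_1_eq_Suc]] mult.assoc mult.commute mult.left_commute)
qed

lemma proots_diff_square: "proots [:- z, 0, 1:] = sqrt_pair z"
proof -
  have "[:- z, 0, 1:] = [:- csqrt z, 1:] * [:csqrt z, 1:]"
    by (simp flip: power2_eq_square)
  also have "proots \<dots> = sqrt_pair z"
    by (subst proots_mult) (auto simp: sqrt_pair_def)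
  finally show ?thesis .
qed

theorem theorem2:
  fixes m n :: nat and a b :: complex
  assumes "m \<ge> 1" and "n = 2 * m"
  shows "eigenvalue_mset (H_mat n a b) =
         {#0#} + (\<Sum>k\<in>{1..m}. sqrt_pair ((2 * of_nat k) * (2 * of_nat k + a + b)))"
proof -
  have "similar_mat (H_mat n a b) (block_mat m a b)"
    using H_mat_mult_dunkl_mat[of m a b] det_dunkl_mat_nonzero[of m] assms(2)
    by (intro similar_mat_if_intertwined[where P = "dunkl_mat m" and n = "n + 1"])
      (auto simp: H_mat_def block_mat_def dunkl_mat_def)
  then have "eigenvalue_mset (H_mat n a b) = proots (char_poly (block_mat m a b))"
    unfolding eigenvalue_mset_def by (simp add: char_poly_similar)
  also have "\<dots> = proots [:0, 1:] +
      proots (\<Prod>k\<in>{1..m}. [:- ((2 * of_nat k) * (2 * of_nat k + a + b)), 0, 1:])"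
    unfolding char_poly_block_mat by (rule proots_mult) auto
  also have "\<dots> = {#0#} + (\<Sum>k\<in>{1..m}. sqrt_pair ((2 * of_nat k) * (2 * of_nat k + a + b)))"
    by (subst proots_prod) (simp_all only: proots_diff_square, auto)
  finally show ?thesis .
qed

end
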